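(* If $X$ is a compactum, then $\prod_u^{\omega}X$ is realcompact.
   Context: A compactum is a compact Hausdorff space. A (Tychonoff) space is realcompact if every ultrafilter of zero sets of the space with the countable intersection property is fixed, i.e. has nonempty intersection. Countable uniform power: let $X$ be compact and let $\mathfrak{U}$ be its unique compatible uniformity. For $U\in\mathfrak{U}$ let $\widetilde U=\{\langle f,g\rangle: f,g\in {}^{\omega}X,\ \forall n<\omega\ \langle f(n),g(n)\rangle\in U\}$. The sets $\widetilde U$, $U\in\mathfrak{U}$, form a base of a uniformity on ${}^{\omega}X$, and $\prod_u^{\omega}X$ is the set ${}^{\omega}X$ with the topology generated by this uniformity. *)

theory Defs
  imports "HOL-Analysis.Analysis"
begin

definition uniformity_on :: "'a set \<Rightarrow> ('a \<times> 'a) set set \<Rightarrow> bool" where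
  "uniformity_on S \<UU> \<longleftrightarrow>
     \<UU> \<noteq> {} \<and>
     (\<forall>U\<in>\<UU>. Id_on S \<subseteq> U \<and> U \<subseteq> S \<times> S) \<and>
     (\<forall>U\<in>\<UU>. \<forall>V. U \<subseteq> V \<and> V \<subseteq> S \<times> S \<longrightarrow> V \<in> \<UU>) \<and>
     (\<forall>U\<in>\<UU>. \<forall>V\<in>\<UU>. U \<inter> V \<in> \<UU>) \<and>
     (\<forall>U\<in>\<UU>. U\<inverse> \<in> \<UU>) \<and>
     (\<forall>U\<in>\<UU>. \<exists>V\<in>\<UU>. V O V \<subseteq> U)"

definition uniform_topology :: "'a set \<Rightarrow> ('a \<times> 'a) set set \<Rightarrow> 'a topology" where
  "uniform_topology S \<UU> = topology (\<lambda>W. W \<subseteq> S \<and> (\<forall>x\<in>W. \<exists>U\<in>\<UU>. U `` {x} \<subseteq> W))"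

lemma openin_uniform_topology:
  assumes "uniformity_on S \<UU>"
  shows "openin (uniform_topology S \<UU>) W \<longleftrightarrow> W \<subseteq> S \<and> (\<forall>x\<in>W. \<exists>U\<in>\<UU>. U `` {x} \<subseteq> W)"
proof -
  have inter: "\<exists>U\<in>\<UU>. U `` {x} \<subseteq> A \<inter> B"
    if AB: "\<exists>U\<in>\<UU>. U `` {x} \<subseteq> A" "\<exists>U\<in>\<UU>. U `` {x} \<subseteq> B" for x A B
  proof -
    obtain U V where "U \<in> \<UU>" "V \<in> \<UU>" "U `` {x} \<subseteq> A" "V `` {x} \<subseteq> B"
      using AB by blast
    moreover have "U \<inter> V \<in> \<UU>"
      using assms \<open>U \<in> \<UU>\<close> \<open>V \<in> \<UU>\<close> unfolding uniformity_on_def by blast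
    ultimately show ?thesis
      by (intro bexI[of _ "U \<inter> V"]) auto
  qed
  have "istopology (\<lambda>W. W \<subseteq> S \<and> (\<forall>x\<in>W. \<exists>U\<in>\<UU>. U `` {x} \<subseteq> W))"
    unfolding istopology_def
  proof (intro conjI allI impI ballI)
    fix A B x
    assume "A \<subseteq> S \<and> (\<forall>x\<in>A. \<exists>U\<in>\<UU>. U `` {x} \<subseteq> A)"
      and "B \<subseteq> S \<and> (\<forall>x\<in>B. \<exists>U\<in>\<UU>. U `` {x} \<subseteq> B)" and "x \<in> A \<inter> B"
    then show "\<exists>U\<in>\<UU>. U `` {x} \<subseteq> A \<inter> B"
      by (intro inter) auto
  next
    fix \<K> x
    assume *: "\<forall>K\<in>\<K>. K \<subseteq> S \<and> (\<forall>x\<in>K. \<exists>U\<in>\<UU>. U `` {x} \<subseteq> K)" and "x \<in> \<Union>\<K>"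
    then obtain K U where "K \<in> \<K>" "U \<in> \<UU>" "U `` {x} \<subseteq> K"
      by (metis UnionE)
    then show "\<exists>U\<in>\<UU>. U `` {x} \<subseteq> \<Union>\<K>"
      by blast
  qed auto
  then show ?thesis
    by (simp add: uniform_topology_def)
qed

definition compatible_uniformity :: "'a topology \<Rightarrow> ('a \<times> 'a) set set \<Rightarrow> bool" where
  "compatible_uniformity X \<UU> \<longleftrightarrow>
     uniformity_on (topspace X) \<UU> \<and> uniform_topology (topspace X) \<UU> = X"

text \<open>Meaningful only when there is exactly one compatible uniformity, as is the case
  for every compact Hausdorff space.\<close>

definition the_uniformity :: "'a topology \<Rightarrow> ('a \<times> 'a) set set" where
  "the_uniformity X = (THE \<UU>. compatible_uniformity X \<UU>)"

definition uniformity_generated :: "'a set \<Rightarrow> ('a \<times> 'a) set set \<Rightarrow> ('a \<times> 'a) set set" where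
  "uniformity_generated S \<B> = {W. W \<subseteq> S \<times> S \<and> (\<exists>B\<in>\<B>. B \<subseteq> W)}"

definition power_carrier :: "'a set \<Rightarrow> (nat \<Rightarrow> 'a) set" where
  "power_carrier S = {f. \<forall>n. f n \<in> S}"

definition power_entourage ::
    "'a set \<Rightarrow> ('a \<times> 'a) set \<Rightarrow> ((nat \<Rightarrow> 'a) \<times> (nat \<Rightarrow> 'a)) set" where
  "power_entourage S U =
     {(f, g). f \<in> power_carrier S \<and> g \<in> power_carrier S \<and> (\<forall>n. (f n, g n) \<in> U)}"

definition power_uniformity ::
    "'a set \<Rightarrow> ('a \<times> 'a) set set \<Rightarrow> ((nat \<Rightarrow> 'a) \<times> (nat \<Rightarrow> 'a)) set set" where
  "power_uniformity S \<UU> =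
     uniformity_generated (power_carrier S) (power_entourage S ` \<UU>)"

lemma uniformity_on_power:
  assumes "uniformity_on S \<UU>"
  shows "uniformity_on (power_carrier S) (power_uniformity S \<UU>)"
proof -
  let ?C = "power_carrier S" and ?E = "power_entourage S"
  have mem: "W \<in> power_uniformity S \<UU> \<longleftrightarrow> W \<subseteq> ?C \<times> ?C \<and> (\<exists>U\<in>\<UU>. ?E U \<subseteq> W)" for W
    by (auto simp: power_uniformity_def uniformity_generated_def)
  note axs = assms[unfolded uniformity_on_def]
  note ne = axs[THEN conjunct1]
    and axs2 = axs[THEN conjunct2]
  note base = axs2[THEN conjunct1]
    and axs4 = axs2[THEN conjunct2, THEN conjunct2]
  note inter = bspec[OF bspec[OF axs4[THEN conjunct1]]]
    and axs5 = axs4[THEN conjunct2]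
  note conv = bspec[OF axs5[THEN conjunct1]]
    and half = bspec[OF axs5[THEN conjunct2]]
    and refl = bspec[OF base, THEN conjunct1]
  have sub: "?E U \<subseteq> ?C \<times> ?C" for U
    by (auto simp: power_entourage_def)
  show ?thesis
    unfolding uniformity_on_def
  proof (intro conjI ballI allI impI)
    show "power_uniformity S \<UU> \<noteq> {}"
    proof -
      obtain U where "U \<in> \<UU>" using ne by blast
      then have "?E U \<in> power_uniformity S \<UU>"
        unfolding mem using sub by blast
      then show ?thesis by blast
    qed
  next
    fix W assume "W \<in> power_uniformity S \<UU>"
    then obtain U where U: "U \<in> \<UU>" "?E U \<subseteq> W" and W: "W \<subseteq> ?C \<times> ?C"
      unfolding mem by blast
    have "Id_on ?C \<subseteq> ?E U"
      using refl[OF U(1)] by (auto simp: power_entourage_def power_carrier_def)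
    with U show "Id_on ?C \<subseteq> W" by blast
    show "W \<subseteq> ?C \<times> ?C" by (rule W)
    have "?E (U\<inverse>) \<subseteq> W\<inverse>"
      using U(2) by (auto simp: power_entourage_def)
    then show "W\<inverse> \<in> power_uniformity S \<UU>"
      unfolding mem using W conv[OF U(1)] by blast
    obtain V where V: "V \<in> \<UU>" "V O V \<subseteq> U"
      using half[OF U(1)] by blast
    have "?E V O ?E V \<subseteq> ?E U"
      using V(2) unfolding power_entourage_def by blast
    then have "?E V O ?E V \<subseteq> W"
      using U(2) by (rule subset_trans)
    moreover have "?E V \<in> power_uniformity S \<UU>"
      unfolding mem using V(1) sub by blast
    ultimately show "\<exists>V\<in>power_uniformity S \<UU>. V O V \<subseteq> W" ..
  next
    fix W V assume "W \<in> power_uniformity S \<UU>" "W \<subseteq> V \<and> V \<subseteq> ?C \<times> ?C"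
    then show "V \<in> power_uniformity S \<UU>"
      unfolding mem by (meson subset_trans)
  next
    fix W V assume "W \<in> power_uniformity S \<UU>" "V \<in> power_uniformity S \<UU>"
    then obtain A B where AB: "A \<in> \<UU>" "B \<in> \<UU>" and "?E A \<subseteq> W" "?E B \<subseteq> V"
      and W: "W \<subseteq> ?C \<times> ?C"
      unfolding mem by blast
    moreover have "?E (A \<inter> B) \<subseteq> ?E A \<inter> ?E B"
      by (auto simp: power_entourage_def)
    ultimately have "?E (A \<inter> B) \<subseteq> W \<inter> V" "W \<inter> V \<subseteq> ?C \<times> ?C"
      by blast+
    with inter[OF AB] show "W \<inter> V \<in> power_uniformity S \<UU>"
      unfolding mem by blast
  qed
qed

definition countable_uniform_power :: "'a topology \<Rightarrow> (nat \<Rightarrow> 'a) topology" where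
  "countable_uniform_power X =
     uniform_topology (power_carrier (topspace X))
       (power_uniformity (topspace X) (the_uniformity X))"

definition zero_set_of :: "'a topology \<Rightarrow> 'a set \<Rightarrow> bool" where
  "zero_set_of Y Z \<longleftrightarrow>
     (\<exists>h. continuous_map Y euclideanreal h \<and> Z = {y \<in> topspace Y. h y = 0})"

definition z_filter :: "'a topology \<Rightarrow> 'a set set \<Rightarrow> bool" where
  "z_filter Y \<F> \<longleftrightarrow>
     \<F> \<noteq> {} \<and> {} \<notin> \<F> \<and>
     (\<forall>Z\<in>\<F>. zero_set_of Y Z) \<and>
     (\<forall>Z\<in>\<F>. \<forall>Z'\<in>\<F>. Z \<inter> Z' \<in> \<F>) \<and>
     (\<forall>Z\<in>\<F>. \<forall>Z'. zero_set_of Y Z' \<and> Z \<subseteq> Z' \<longrightarrow> Z' \<in> \<F>)"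

definition z_ultrafilter :: "'a topology \<Rightarrow> 'a set set \<Rightarrow> bool" where
  "z_ultrafilter Y \<F> \<longleftrightarrow>
     z_filter Y \<F> \<and> (\<forall>\<G>. z_filter Y \<G> \<and> \<F> \<subseteq> \<G> \<longrightarrow> \<G> = \<F>)"

definition countable_intersection_property :: "'a set set \<Rightarrow> bool" where
  "countable_intersection_property \<F> \<longleftrightarrow>
     (\<forall>\<C>. countable \<C> \<and> \<C> \<noteq> {} \<and> \<C> \<subseteq> \<F> \<longrightarrow> \<Inter>\<C> \<noteq> {})"

text \<open>The Tychonoff property is part of realcompactness.\<close>

definition realcompact_space :: "'a topology \<Rightarrow> bool" where
  "realcompact_space Y \<longleftrightarrow>
     completely_regular_space Y \<and> Hausdorff_space Y \<and>
     (\<forall>\<F>. z_ultrafilter Y \<F> \<and> countable_intersection_property \<F> \<longrightarrow> \<Inter>\<F> \<noteq> {})"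

end

theory Submission
  imports Defs
begin

text \<open>
  Let \<open>Y\<close> be the countable uniform power of \<open>X\<close> and let \<open>\<F>\<close> be a z-ultrafilter on \<open>Y\<close> with the
  countable intersection property.  For each \<open>n\<close> the evaluation \<open>f \<mapsto> f n\<close> is continuous, so by
  compactness the image of \<open>\<F>\<close> under it clusters at a point \<open>p n\<close> of \<open>X\<close>; since \<open>\<F>\<close> is prime, this
  is a limit in the sense that the preimage of each zero-set neighbourhood of \<open>p n\<close> belongs to \<open>\<F>\<close>
  (\<open>z_ultrafilter_image_limit\<close>).  The sequence \<open>p\<close> lies in every member \<open>Z\<close> of \<open>\<F>\<close>.  Otherwise, \<open>Z\<close>
  being closed, there is an entourage \<open>U\<close> of \<open>X\<close> such that no \<open>f \<in> Z\<close> satisfies \<open>(p n, f n) \<in> U\<close> for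
  all \<open>n\<close>.  Choose, for each \<open>n\<close>, a zero-set neighbourhood of \<open>p n\<close> inside \<open>U `` {p n}\<close>.  Their
  preimages are countably many members of \<open>\<F>\<close>, so together with \<open>Z\<close> they have a common point \<open>f\<close>,
  and \<open>(p n, f n) \<in> U\<close> for all \<open>n\<close> after all.

  It remains to identify the uniformity of \<open>X\<close> and to show that \<open>Y\<close> is Tychonoff.  For an open
  neighbourhood \<open>G\<close> of the diagonal let \<open>g\<close> be a Urysohn function on \<open>X \<times> X\<close> which is \<open>0\<close> on the
  diagonal and \<open>1\<close> off \<open>G\<close>.  The pseudometric \<open>d x y = (SUP z. \<bar>g (x, z) - g (y, z)\<bar>)\<close> is less than
  \<open>1\<close> only on \<open>G\<close>, and by the tube lemma its balls are neighbourhoods of the diagonal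
  (\<open>diagonal_nbhds_pseudometric\<close>).  These pseudometrics show that the neighbourhoods of the
  diagonal form a uniformity, and the functions \<open>k \<mapsto> (SUP n. d (f n) (k n))\<close> show that \<open>Y\<close> is
  completely regular.
\<close>

section \<open>Uniform topologies\<close>

lemma uniformity_onD:
  assumes "uniformity_on S \<UU>"
  shows "\<UU> \<noteq> {}"
    and "\<And>U. U \<in> \<UU> \<Longrightarrow> Id_on S \<subseteq> U"
    and "\<And>U. U \<in> \<UU> \<Longrightarrow> U \<subseteq> S \<times> S"
    and "\<And>U V. U \<in> \<UU> \<Longrightarrow> U \<subseteq> V \<Longrightarrow> V \<subseteq> S \<times> S \<Longrightarrow> V \<in> \<UU>"
    and "\<And>U V. U \<in> \<UU> \<Longrightarrow> V \<in> \<UU> \<Longrightarrow> U \<inter> V \<in> \<UU>"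
    and "\<And>U. U \<in> \<UU> \<Longrightarrow> U\<inverse> \<in> \<UU>"
    and "\<And>U. U \<in> \<UU> \<Longrightarrow> \<exists>V\<in>\<UU>. V O V \<subseteq> U"
  using assms unfolding uniformity_on_def by meson+

lemma topspace_uniform_topology:
  assumes "uniformity_on S \<UU>"
  shows "topspace (uniform_topology S \<UU>) = S"
proof -
  have "openin (uniform_topology S \<UU>) S"
    using uniformity_onD(1,3)[OF assms] unfolding openin_uniform_topology[OF assms] by blast
  moreover have "topspace (uniform_topology S \<UU>) \<subseteq> S"
    using openin_topspace[of "uniform_topology S \<UU>"]
    unfolding openin_uniform_topology[OF assms] by (rule conjunct1)
  ultimately show ?thesis
    by (intro subset_antisym openin_subset)
qed

text \<open>The sets \<open>U `` {x}\<close> need not be open; the axiom on half-size entourages makes them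
  neighbourhoods of \<open>x\<close>.\<close>

lemma uniform_nbhd:
  assumes \<UU>: "uniformity_on S \<UU>" and "U \<in> \<UU>" and "x \<in> S"
  obtains W where "openin (uniform_topology S \<UU>) W" "x \<in> W" "W \<subseteq> U `` {x}"
proof
  let ?W = "{y \<in> S. \<exists>V\<in>\<UU>. V `` {y} \<subseteq> U `` {x}}"
  show "openin (uniform_topology S \<UU>) ?W"
    unfolding openin_uniform_topology[OF \<UU>]
  proof (intro conjI ballI)
    fix y assume "y \<in> ?W"
    then obtain V where "V \<in> \<UU>" "V `` {y} \<subseteq> U `` {x}" by blast
    moreover obtain V' where "V' \<in> \<UU>" "V' O V' \<subseteq> V"
      using uniformity_onD(7)[OF \<UU> \<open>V \<in> \<UU>\<close>] by blast
    moreover have "V' \<subseteq> S \<times> S"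
      using uniformity_onD(3)[OF \<UU> \<open>V' \<in> \<UU>\<close>] .
    ultimately show "\<exists>V\<in>\<UU>. V `` {y} \<subseteq> ?W"
      by (intro bexI[of _ V']) blast+
  qed blast
  show "x \<in> ?W" using assms by blast
  show "?W \<subseteq> U `` {x}"
    using uniformity_onD(2)[OF \<UU>] by blast
qed

lemma continuous_map_uniform_real:
  fixes h :: "'a \<Rightarrow> real"
  assumes \<UU>: "uniformity_on S \<UU>"
    and h: "\<And>e. e > 0 \<Longrightarrow> \<exists>U\<in>\<UU>. \<forall>(x, y)\<in>U. \<bar>h x - h y\<bar> < e"
  shows "continuous_map (uniform_topology S \<UU>) euclideanreal h"
  unfolding continuous_map_def topspace_uniform_topology[OF \<UU>] openin_uniform_topology[OF \<UU>]
proof (intro conjI allI impI ballI)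
  fix T :: "real set" and x
  assume "openin euclideanreal T" and x: "x \<in> {x \<in> S. h x \<in> T}"
  then obtain e where "e > 0" and e: "\<And>t. \<bar>t - h x\<bar> < e \<Longrightarrow> t \<in> T"
    by (auto simp: open_dist dist_real_def)
  then obtain U where "U \<in> \<UU>" and U: "\<forall>(x, y)\<in>U. \<bar>h x - h y\<bar> < e"
    using h by blast
  have "U \<subseteq> S \<times> S" by (rule uniformity_onD(3)[OF \<UU> \<open>U \<in> \<UU>\<close>])
  moreover have "h y \<in> T" if "(x, y) \<in> U" for y
    using U that by (intro e) (auto simp: abs_minus_commute)
  ultimately show "\<exists>U\<in>\<UU>. U `` {x} \<subseteq> {x \<in> S. h x \<in> T}"
    using \<open>U \<in> \<UU>\<close> by (intro bexI[of _ U]) auto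
qed auto

section \<open>The uniformity of a compact Hausdorff space\<close>

text \<open>The neighbourhoods of the diagonal, with respect to the product topology, as subsets of the
  square of the carrier.\<close>

definition diagonal_nbhds :: "'a topology \<Rightarrow> ('a \<times> 'a) set set" where
  "diagonal_nbhds X =
     {N. N \<subseteq> topspace X \<times> topspace X \<and>
         (\<exists>G. openin (prod_topology X X) G \<and> Id_on (topspace X) \<subseteq> G \<and> G \<subseteq> N)}"

text \<open>Membership is handled through open squares \<open>W \<times> W\<close>, which form a neighbourhood
  base of the product topology at the points of the diagonal.\<close>

lemma diagonal_nbhdsI:
  assumes "N \<subseteq> topspace X \<times> topspace X"
    and "\<And>x. x \<in> topspace X \<Longrightarrow> \<exists>W. openin X W \<and> x \<in> W \<and> W \<times> W \<subseteq> N"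
  shows "N \<in> diagonal_nbhds X"
proof -
  let ?G = "\<Union>{W \<times> W | W. openin X W \<and> W \<times> W \<subseteq> N}"
  have "openin (prod_topology X X) ?G"
    by (intro openin_Union) (auto simp: openin_prod_Times_iff)
  moreover have "Id_on (topspace X) \<subseteq> ?G"
  proof
    fix q assume "q \<in> Id_on (topspace X)"
    then obtain x where x: "q = (x, x)" "x \<in> topspace X" by blast
    with assms(2) obtain W where "openin X W" "x \<in> W" "W \<times> W \<subseteq> N" by blast
    then show "q \<in> ?G" unfolding x(1) by blast
  qed
  ultimately show ?thesis
    using assms(1) unfolding diagonal_nbhds_def by blast
qed

lemma diagonal_nbhdsD:
  assumes "N \<in> diagonal_nbhds X" "x \<in> topspace X"
  obtains W where "openin X W" "x \<in> W" "W \<times> W \<subseteq> N"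
proof -
  obtain G where G: "openin (prod_topology X X) G" "(x, x) \<in> G" "G \<subseteq> N"
    using assms unfolding diagonal_nbhds_def by blast
  then obtain A B where "openin X A" "openin X B" "x \<in> A" "x \<in> B" "A \<times> B \<subseteq> G"
    unfolding openin_prod_topology_alt by meson
  with G show thesis by (intro that[of "A \<inter> B"]) auto
qed

text \<open>The key to both the uniformity axioms and complete regularity: every neighbourhood of the
  diagonal contains the unit ball of a continuous pseudometric.\<close>

lemma diagonal_nbhds_pseudometric:
  assumes X: "compact_space X" "Hausdorff_space X" and N: "N \<in> diagonal_nbhds X"
  obtains d :: "'a \<Rightarrow> 'a \<Rightarrow> real"
  where "\<And>x y. x \<in> topspace X \<Longrightarrow> y \<in> topspace X \<Longrightarrow> 0 \<le> d x y \<and> d x y \<le> 1"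
    and "\<And>x. x \<in> topspace X \<Longrightarrow> d x x = 0"
    and "\<And>x y. d x y = d y x"
    and "\<And>x y z. x \<in> topspace X \<Longrightarrow> y \<in> topspace X \<Longrightarrow> z \<in> topspace X \<Longrightarrow>
           d x z \<le> d x y + d y z"
    and "\<And>x y. x \<in> topspace X \<Longrightarrow> y \<in> topspace X \<Longrightarrow> d x y < 1 \<Longrightarrow> (x, y) \<in> N"
    and "\<And>e. e > 0 \<Longrightarrow>
           {(x, y). x \<in> topspace X \<and> y \<in> topspace X \<and> d x y < e} \<in> diagonal_nbhds X"
proof -
  let ?S = "topspace X" and ?P = "prod_topology X X"
  obtain G where G: "openin ?P G" "Id_on ?S \<subseteq> G" "G \<subseteq> N"
    using N unfolding diagonal_nbhds_def by blast
  have "normal_space ?P"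
    using X by (intro compact_Hausdorff_or_regular_imp_normal_space)
      (auto simp: compact_space_prod_topology Hausdorff_space_prod_topology)
  moreover have "closedin ?P (Id_on ?S)"
  proof -
    have "Id_on ?S = (\<lambda>x. (x, x)) ` ?S" by auto
    then show ?thesis using X(2) by (simp add: Hausdorff_space_closedin_diagonal)
  qed
  moreover have "closedin ?P (?S \<times> ?S - G)"
    using G(1) by (simp add: closedin_def Diff_Diff_Int openin_Int flip: topspace_prod_topology)
  moreover have "disjnt (Id_on ?S) (?S \<times> ?S - G)"
    using G(2) by (auto simp: disjnt_def)
  ultimately obtain g :: "'a \<times> 'a \<Rightarrow> real"
    where g: "continuous_map ?P (top_of_set {0..1}) g"
      and g0: "g ` Id_on ?S \<subseteq> {0}" and g1: "g ` (?S \<times> ?S - G) \<subseteq> {1}"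
    using Urysohn_lemma[of ?P "Id_on ?S" "?S \<times> ?S - G" 0 1] by auto
  have g01: "0 \<le> g (x, y) \<and> g (x, y) \<le> 1" if "x \<in> ?S" "y \<in> ?S" for x y
    using g that by (auto simp: continuous_map_in_subtopology)
  have gc: "continuous_map ?P euclideanreal g"
    using g continuous_map_in_subtopology by blast
  define d where "d x y = (SUP z\<in>?S. \<bar>g (x, z) - g (y, z)\<bar>)" for x y
  have le: "\<bar>g (x, z) - g (y, z)\<bar> \<le> 1" if "x \<in> ?S" "y \<in> ?S" "z \<in> ?S" for x y z
    using g01[of x z] g01[of y z] that by linarith
  have upper: "\<bar>g (x, z) - g (y, z)\<bar> \<le> d x y" if "x \<in> ?S" "y \<in> ?S" "z \<in> ?S" for x y z
    unfolding d_def using that le by (intro cSUP_upper bdd_aboveI2[where M = 1]) auto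
  have least: "d x y \<le> c" if "x \<in> ?S" "\<And>z. z \<in> ?S \<Longrightarrow> \<bar>g (x, z) - g (y, z)\<bar> \<le> c" for x y c
    unfolding d_def using that by (intro cSUP_least) auto
  show thesis
  proof (rule that[of d])
    show "0 \<le> d x y \<and> d x y \<le> 1" if "x \<in> ?S" "y \<in> ?S" for x y
      using upper[OF that that(1)] least[of x y 1] le that by force
    show "d x x = 0" if "x \<in> ?S" for x
      using upper[OF that that that] least[of x x 0] that by force
    show "d x y = d y x" for x y
      by (simp add: d_def abs_minus_commute)
    show "d x z \<le> d x y + d y z" if "x \<in> ?S" "y \<in> ?S" "z \<in> ?S" for x y z
    proof (rule least)
      fix w assume "w \<in> ?S"
      then show "\<bar>g (x, w) - g (z, w)\<bar> \<le> d x y + d y z"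
        using upper[of x y w] upper[of y z w] that by linarith
    qed (rule that)
    show "(x, y) \<in> N" if "x \<in> ?S" "y \<in> ?S" "d x y < 1" for x y
    proof (rule ccontr)
      assume "(x, y) \<notin> N"
      then have "(x, y) \<in> ?S \<times> ?S - G" "(y, y) \<in> Id_on ?S" using that G(3) by auto
      then have "g (x, y) = 1" "g (y, y) = 0" using g0 g1 by blast+
      then show False using upper[of x y y] that by simp
    qed
    fix e :: real assume "e > 0"
    show "{(x, y). x \<in> ?S \<and> y \<in> ?S \<and> d x y < e} \<in> diagonal_nbhds X"
    proof (rule diagonal_nbhdsI)
      fix x assume x: "x \<in> ?S"
      \<comment> \<open>An open set containing \<open>{x} \<times> ?S\<close>; a tube inside it controls the supremum over \<open>z\<close>.\<close>
      let ?H = "{q \<in> topspace ?P. \<bar>g q - g (x, snd q)\<bar> < e / 3}"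
      have c1: "continuous_map ?P euclideanreal (\<lambda>q. g (x, snd q))"
        by (intro continuous_map_compose[OF _ gc, unfolded o_def] continuous_map_pairedI
            continuous_map_const[THEN iffD2] continuous_map_snd) (use x in auto)
      have "continuous_map ?P euclideanreal (\<lambda>q. \<bar>g q - g (x, snd q)\<bar>)"
        by (intro continuous_intros gc c1)
      from openin_continuous_map_preimage[OF this, of "{..<e / 3}"]
      have "openin ?P ?H" by simp
      moreover have "compactin X ?S" using X(1) by (simp add: compact_space_def)
      moreover have "{x} \<times> ?S \<subseteq> ?H" using x \<open>e > 0\<close> by auto
      ultimately obtain W V where W: "openin X W" "x \<in> W" "?S \<subseteq> V" "W \<times> V \<subseteq> ?H"
        using tube_lemma_right[of X X ?H ?S x] x by blast
      have "d y z < e" if "y \<in> W" "z \<in> W" for y z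
      proof -
        have yz: "y \<in> ?S" "z \<in> ?S" using that W(1) openin_subset by blast+
        have "d y z \<le> 2 * e / 3"
        proof (rule least)
          fix w assume "w \<in> ?S"
          with W that have "(y, w) \<in> ?H" "(z, w) \<in> ?H" by blast+
          then have "\<bar>g (y, w) - g (x, w)\<bar> < e / 3" "\<bar>g (z, w) - g (x, w)\<bar> < e / 3" by auto
          then show "\<bar>g (y, w) - g (z, w)\<bar> \<le> 2 * e / 3" by linarith
        qed (rule yz)
        with \<open>e > 0\<close> show ?thesis by simp
      qed
      moreover have "W \<subseteq> ?S" using W(1) openin_subset by blast
      ultimately have "W \<times> W \<subseteq> {(x, y). x \<in> ?S \<and> y \<in> ?S \<and> d x y < e}" by blast
      with W show "\<exists>W. openin X W \<and> x \<in> W \<and>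
          W \<times> W \<subseteq> {(x, y). x \<in> ?S \<and> y \<in> ?S \<and> d x y < e}" by blast
    qed auto
  qed
qed

lemma uniformity_on_diagonal_nbhds:
  assumes X: "compact_space X" "Hausdorff_space X"
  shows "uniformity_on (topspace X) (diagonal_nbhds X)"
  unfolding uniformity_on_def
proof (intro conjI ballI allI impI)
  let ?S = "topspace X"
  show "diagonal_nbhds X \<noteq> {}"
    using diagonal_nbhdsI[of "?S \<times> ?S" X] by blast
  fix U assume U: "U \<in> diagonal_nbhds X"
  show "Id_on ?S \<subseteq> U" "U \<subseteq> ?S \<times> ?S"
    using U unfolding diagonal_nbhds_def by blast+
  show "V \<in> diagonal_nbhds X" if "U \<subseteq> V \<and> V \<subseteq> ?S \<times> ?S" for V
    using U that unfolding diagonal_nbhds_def by blast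
  show "U \<inter> V \<in> diagonal_nbhds X" if V: "V \<in> diagonal_nbhds X" for V
  proof (rule diagonal_nbhdsI)
    show "U \<inter> V \<subseteq> ?S \<times> ?S" using U unfolding diagonal_nbhds_def by blast
    fix x assume x: "x \<in> ?S"
    obtain A where "openin X A" "x \<in> A" "A \<times> A \<subseteq> U" using diagonal_nbhdsD[OF U x] .
    moreover obtain B where "openin X B" "x \<in> B" "B \<times> B \<subseteq> V" using diagonal_nbhdsD[OF V x] .
    ultimately show "\<exists>W. openin X W \<and> x \<in> W \<and> W \<times> W \<subseteq> U \<inter> V"
      by (intro exI[of _ "A \<inter> B"]) auto
  qed
  show "U\<inverse> \<in> diagonal_nbhds X"
  proof (rule diagonal_nbhdsI)
    show "U\<inverse> \<subseteq> ?S \<times> ?S" using U unfolding diagonal_nbhds_def by blast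
    fix x assume "x \<in> ?S"
    then obtain A where "openin X A" "x \<in> A" "A \<times> A \<subseteq> U" using diagonal_nbhdsD[OF U] by blast
    then show "\<exists>W. openin X W \<and> x \<in> W \<and> W \<times> W \<subseteq> U\<inverse>" by blast
  qed
  obtain d :: "'a \<Rightarrow> 'a \<Rightarrow> real"
    where d01: "\<And>x y. x \<in> ?S \<Longrightarrow> y \<in> ?S \<Longrightarrow> 0 \<le> d x y \<and> d x y \<le> 1"
      and d0: "\<And>x. x \<in> ?S \<Longrightarrow> d x x = 0"
      and dsym: "\<And>x y. d x y = d y x"
      and tri: "\<And>x y z. x \<in> ?S \<Longrightarrow> y \<in> ?S \<Longrightarrow> z \<in> ?S \<Longrightarrow> d x z \<le> d x y + d y z"
      and dU: "\<And>x y. x \<in> ?S \<Longrightarrow> y \<in> ?S \<Longrightarrow> d x y < 1 \<Longrightarrow> (x, y) \<in> U"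
      and nb: "\<And>e. e > 0 \<Longrightarrow> {(x, y). x \<in> ?S \<and> y \<in> ?S \<and> d x y < e} \<in> diagonal_nbhds X"
    by (rule diagonal_nbhds_pseudometric[OF X U]) (rule that; assumption)
  let ?V = "{(x, y). x \<in> ?S \<and> y \<in> ?S \<and> d x y < 1/2}"
  have "?V O ?V \<subseteq> U"
  proof clarify
    fix x y z assume "x \<in> ?S" "y \<in> ?S" "z \<in> ?S" "d x y < 1/2" "d y z < 1/2"
    then show "(x, z) \<in> U" using tri[of x y z] by (intro dU) auto
  qed
  then show "\<exists>V\<in>diagonal_nbhds X. V O V \<subseteq> U"
    using nb[of "1/2"] by auto
qed

lemma compatible_diagonal_nbhds:
  assumes X: "compact_space X" "Hausdorff_space X"
  shows "compatible_uniformity X (diagonal_nbhds X)"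
  unfolding compatible_uniformity_def
proof
  let ?S = "topspace X" and ?P = "prod_topology X X"
  show \<UU>: "uniformity_on ?S (diagonal_nbhds X)"
    by (rule uniformity_on_diagonal_nbhds[OF X])
  show "uniform_topology ?S (diagonal_nbhds X) = X"
    unfolding topology_eq openin_uniform_topology[OF \<UU>]
  proof (intro allI iffI conjI ballI)
    fix W assume W: "W \<subseteq> ?S \<and> (\<forall>x\<in>W. \<exists>U\<in>diagonal_nbhds X. U `` {x} \<subseteq> W)"
    show "openin X W"
    proof (subst openin_subopen, intro ballI)
      fix x assume "x \<in> W"
      with W obtain U where "U \<in> diagonal_nbhds X" "U `` {x} \<subseteq> W" "x \<in> ?S" by blast
      then obtain A where "openin X A" "x \<in> A" "A \<times> A \<subseteq> U" using diagonal_nbhdsD by metis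
      with \<open>U `` {x} \<subseteq> W\<close> show "\<exists>T. openin X T \<and> x \<in> T \<and> T \<subseteq> W" by blast
    qed
  next
    fix W x assume W: "openin X W" and "x \<in> W"
    then have x: "x \<in> ?S" using openin_subset by blast
    \<comment> \<open>The largest relation whose section at \<open>x\<close> is \<open>W\<close>; it is open because points are closed.\<close>
    let ?U = "?S \<times> ?S - {x} \<times> (?S - W)"
    have "closedin X {x}" using X(2) x closedin_Hausdorff_singleton by metis
    then have "closedin ?P ({x} \<times> (?S - W))"
      using W by (simp add: closedin_prod_Times_iff closedin_diff)
    then have "openin ?P ?U" by (simp add: closedin_def)
    then have "?U \<in> diagonal_nbhds X"
      using \<open>x \<in> W\<close> unfolding diagonal_nbhds_def by auto
    moreover have "?U `` {x} \<subseteq> W" by auto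
    ultimately show "\<exists>U\<in>diagonal_nbhds X. U `` {x} \<subseteq> W" by blast
  qed (use openin_subset in blast)
qed

text \<open>Every compatible uniformity consists of neighbourhoods of the diagonal, and compactness makes
  each of these an entourage.\<close>

lemma compatible_uniformity_unique:
  assumes X: "compact_space X" and \<VV>: "compatible_uniformity X \<VV>"
  shows "\<VV> = diagonal_nbhds X"
proof
  let ?S = "topspace X"
  have u: "uniformity_on ?S \<VV>" and top: "uniform_topology ?S \<VV> = X"
    using \<VV> by (auto simp: compatible_uniformity_def)
  note sub = uniformity_onD(3)[OF u] and up = uniformity_onD(4)[OF u]
    and inter = uniformity_onD(5)[OF u] and conv = uniformity_onD(6)[OF u]
    and half = uniformity_onD(7)[OF u]
  have nbhd: "\<exists>A. openin X A \<and> x \<in> A \<and> A \<subseteq> V `` {x}" if "V \<in> \<VV>" "x \<in> ?S" for V x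
    using uniform_nbhd[OF u that] unfolding top by metis
  show "\<VV> \<subseteq> diagonal_nbhds X"
  proof
    fix V assume V: "V \<in> \<VV>"
    then obtain W where W: "W \<in> \<VV>" "W O W \<subseteq> V" using half by blast
    let ?W = "W \<inter> W\<inverse>"
    show "V \<in> diagonal_nbhds X"
    proof (rule diagonal_nbhdsI[OF sub[OF V]])
      fix x assume "x \<in> ?S"
      then obtain A where "openin X A" "x \<in> A" "A \<subseteq> ?W `` {x}"
        using nbhd[OF inter[OF W(1) conv[OF W(1)]]] by blast
      with W(2) show "\<exists>A. openin X A \<and> x \<in> A \<and> A \<times> A \<subseteq> V" by blast
    qed
  qed
  show "diagonal_nbhds X \<subseteq> \<VV>"
  proof
    fix N assume N: "N \<in> diagonal_nbhds X"
    \<comment> \<open>The open sets over which \<open>N\<close> contains an entourage cover the space, and finite unions of them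
      have the same property.\<close>
    define \<A> where "\<A> = {A. openin X A \<and> (\<exists>V\<in>\<VV>. V \<inter> A \<times> ?S \<subseteq> N)}"
    have cover: "\<exists>A\<in>\<A>. x \<in> A" if x: "x \<in> ?S" for x
    proof -
      obtain B where B: "openin X B" "x \<in> B" "B \<times> B \<subseteq> N" using diagonal_nbhdsD[OF N x] .
      then obtain V where V: "V \<in> \<VV>" "V `` {x} \<subseteq> B"
        using openin_uniform_topology[OF u, of B] unfolding top by blast
      then obtain W where W: "W \<in> \<VV>" "W O W \<subseteq> V" using half by blast
      obtain A where A: "openin X A" "x \<in> A" "A \<subseteq> W `` {x}"
        using nbhd[OF W(1) x] by blast
      have "W \<inter> A \<times> ?S \<subseteq> N"
      proof
        fix q assume q: "q \<in> W \<inter> A \<times> ?S"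
        obtain y z where yz: "q = (y, z)" by (cases q)
        then have "(y, z) \<in> W" "y \<in> A" using q by auto
        then have "(x, y) \<in> W" "(y, y) \<in> W"
          using A(3) sub[OF W(1)] uniformity_onD(2)[OF u W(1)] by blast+
        then have "(x, y) \<in> V" "(x, z) \<in> V"
          using W(2) \<open>(y, z) \<in> W\<close> by (meson relcomp.relcompI subsetD)+
        then have "y \<in> B" "z \<in> B" using V(2) by blast+
        then show "q \<in> N" using B(3) yz by blast
      qed
      with A W(1) show ?thesis by (auto simp: \<A>_def)
    qed
    moreover have "\<forall>A\<in>\<A>. openin X A" by (simp add: \<A>_def)
    ultimately obtain \<F> where \<F>: "finite \<F>" "\<F> \<subseteq> \<A>" "?S \<subseteq> \<Union>\<F>"
      using X unfolding compact_space_alt by (meson UnionI subsetI)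
    have "\<exists>V\<in>\<VV>. V \<inter> \<Union>\<F> \<times> ?S \<subseteq> N" using \<F>(1,2)
    proof (induction \<F> rule: finite_induct)
      case empty
      then show ?case using uniformity_onD(1)[OF u] by auto
    next
      case (insert A \<F>)
      then obtain V where V: "V \<in> \<VV>" "V \<inter> \<Union>\<F> \<times> ?S \<subseteq> N" by auto
      obtain V' where V': "V' \<in> \<VV>" "V' \<inter> A \<times> ?S \<subseteq> N"
        using insert.prems by (auto simp: \<A>_def)
      have "V' \<inter> V \<inter> \<Union>(insert A \<F>) \<times> ?S \<subseteq> N" using V(2) V'(2) by auto
      with inter[OF V'(1) V(1)] show ?case by blast
    qed
    then obtain V where V: "V \<in> \<VV>" "V \<inter> \<Union>\<F> \<times> ?S \<subseteq> N" by blast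
    moreover have "V \<subseteq> \<Union>\<F> \<times> ?S" using sub[OF V(1)] \<F>(3) by auto
    ultimately have "V \<subseteq> N" by blast
    moreover have "N \<subseteq> ?S \<times> ?S" using N unfolding diagonal_nbhds_def by blast
    ultimately show "N \<in> \<VV>" using up V(1) by blast
  qed
qed

lemma the_uniformity_compact_Hausdorff:
  assumes "compact_space X" "Hausdorff_space X"
  shows "the_uniformity X = diagonal_nbhds X"
  unfolding the_uniformity_def
  using assms compatible_diagonal_nbhds compatible_uniformity_unique by (intro the_equality) auto

section \<open>The countable uniform power\<close>

context
  fixes X :: "'a topology"
  assumes X: "compact_space X" "Hausdorff_space X"
begin

lemma uniformity_on_uniform_power:
  "uniformity_on (power_carrier (topspace X)) (power_uniformity (topspace X) (diagonal_nbhds X))"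
  by (intro uniformity_on_power uniformity_on_diagonal_nbhds X)

lemma countable_uniform_power_eq:
  "countable_uniform_power X =
     uniform_topology (power_carrier (topspace X))
       (power_uniformity (topspace X) (diagonal_nbhds X))"
  by (simp add: countable_uniform_power_def the_uniformity_compact_Hausdorff X)

lemma topspace_countable_uniform_power:
  "topspace (countable_uniform_power X) = power_carrier (topspace X)"
  by (simp add: countable_uniform_power_eq topspace_uniform_topology uniformity_on_uniform_power)

lemma power_entourage_in_uniformity:
  assumes "U \<in> diagonal_nbhds X"
  shows "power_entourage (topspace X) U \<in> power_uniformity (topspace X) (diagonal_nbhds X)"
  using assms unfolding power_uniformity_def uniformity_generated_def power_entourage_def by blast

lemma openin_countable_uniform_power:
  "openin (countable_uniform_power X) W \<longleftrightarrow>
     W \<subseteq> power_carrier (topspace X) \<and>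
     (\<forall>f\<in>W. \<exists>U\<in>diagonal_nbhds X. power_entourage (topspace X) U `` {f} \<subseteq> W)"
proof -
  let ?S = "topspace X"
  have "(\<exists>E\<in>power_uniformity ?S (diagonal_nbhds X). E `` {f} \<subseteq> W) \<longleftrightarrow>
        (\<exists>U\<in>diagonal_nbhds X. power_entourage ?S U `` {f} \<subseteq> W)" for f
  proof
    assume "\<exists>E\<in>power_uniformity ?S (diagonal_nbhds X). E `` {f} \<subseteq> W"
    then obtain E U where "E `` {f} \<subseteq> W" "U \<in> diagonal_nbhds X" "power_entourage ?S U \<subseteq> E"
      unfolding power_uniformity_def uniformity_generated_def by blast
    then show "\<exists>U\<in>diagonal_nbhds X. power_entourage ?S U `` {f} \<subseteq> W" by blast
  next
    assume "\<exists>U\<in>diagonal_nbhds X. power_entourage ?S U `` {f} \<subseteq> W"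
    then show "\<exists>E\<in>power_uniformity ?S (diagonal_nbhds X). E `` {f} \<subseteq> W"
      using power_entourage_in_uniformity by (elim bexE) (rule bexI)
  qed
  then show ?thesis
    unfolding countable_uniform_power_eq openin_uniform_topology[OF uniformity_on_uniform_power]
    by simp
qed

lemma continuous_map_evaluation:
  "continuous_map (countable_uniform_power X) X (\<lambda>f. f n)"
  unfolding continuous_map_def topspace_countable_uniform_power openin_countable_uniform_power
proof (intro conjI allI impI ballI)
  show "(\<lambda>f. f n) \<in> power_carrier (topspace X) \<rightarrow> topspace X"
    by (auto simp: power_carrier_def)
  fix V f assume V: "openin X V" and f: "f \<in> {f \<in> power_carrier (topspace X). f n \<in> V}"
  have "uniform_topology (topspace X) (diagonal_nbhds X) = X"
    using compatible_diagonal_nbhds[OF X] by (simp add: compatible_uniformity_def)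
  with V f obtain U where U: "U \<in> diagonal_nbhds X" "U `` {f n} \<subseteq> V"
    using openin_uniform_topology[OF uniformity_on_diagonal_nbhds[OF X], of V] by auto
  then show "\<exists>U\<in>diagonal_nbhds X. power_entourage (topspace X) U `` {f}
               \<subseteq> {f \<in> power_carrier (topspace X). f n \<in> V}"
    by (intro bexI[of _ U]) (auto simp: power_entourage_def)
qed auto

lemma Hausdorff_countable_uniform_power: "Hausdorff_space (countable_uniform_power X)"
  unfolding Hausdorff_space_def
proof clarify
  let ?Y = "countable_uniform_power X"
  fix f g assume f: "f \<in> topspace ?Y" and g: "g \<in> topspace ?Y" and "f \<noteq> g"
  then obtain n where n: "f n \<noteq> g n" by blast
  moreover have "f n \<in> topspace X" "g n \<in> topspace X"
    using f g by (auto simp: topspace_countable_uniform_power power_carrier_def)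
  ultimately obtain A B where AB: "openin X A" "openin X B" "f n \<in> A" "g n \<in> B" "disjnt A B"
    using X(2) unfolding Hausdorff_space_def by metis
  let ?E = "\<lambda>A. {f \<in> topspace ?Y. f n \<in> A}"
  have "openin ?Y (?E A)" "openin ?Y (?E B)"
    using openin_continuous_map_preimage[OF continuous_map_evaluation] AB by blast+
  moreover have "f \<in> ?E A" "g \<in> ?E B" "disjnt (?E A) (?E B)"
    using f g AB by (auto simp: disjnt_def)
  ultimately show "\<exists>U V. openin ?Y U \<and> openin ?Y V \<and> f \<in> U \<and> g \<in> V \<and> disjnt U V" by blast
qed

lemma completely_regular_countable_uniform_power:
  "completely_regular_space (countable_uniform_power X)"
  unfolding completely_regular_space_alt'
proof (intro allI impI)
  let ?Y = "countable_uniform_power X" and ?S = "topspace X"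
  fix W f assume W: "openin ?Y W" and f: "f \<in> W"
  then obtain U where U: "U \<in> diagonal_nbhds X" "power_entourage ?S U `` {f} \<subseteq> W"
    unfolding openin_countable_uniform_power by blast
  obtain d :: "'a \<Rightarrow> 'a \<Rightarrow> real"
    where d01: "\<And>x y. x \<in> ?S \<Longrightarrow> y \<in> ?S \<Longrightarrow> 0 \<le> d x y \<and> d x y \<le> 1"
      and d0: "\<And>x. x \<in> ?S \<Longrightarrow> d x x = 0"
      and dsym: "\<And>x y. d x y = d y x"
      and tri: "\<And>x y z. x \<in> ?S \<Longrightarrow> y \<in> ?S \<Longrightarrow> z \<in> ?S \<Longrightarrow> d x z \<le> d x y + d y z"
      and dU: "\<And>x y. x \<in> ?S \<Longrightarrow> y \<in> ?S \<Longrightarrow> d x y < 1 \<Longrightarrow> (x, y) \<in> U"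
      and nb: "\<And>e. e > 0 \<Longrightarrow> {(x, y). x \<in> ?S \<and> y \<in> ?S \<and> d x y < e} \<in> diagonal_nbhds X"
    by (rule diagonal_nbhds_pseudometric[OF X U(1)]) (rule that; assumption)
  \<comment> \<open>The uniform distance from \<open>f\<close>, with respect to \<open>d\<close>.\<close>
  define h where "h k = (SUP n. d (f n) (k n))" for k
  have "f \<in> power_carrier ?S"
    using W f by (auto simp: openin_countable_uniform_power)
  then have fS: "f n \<in> ?S" for n
    by (simp add: power_carrier_def)
  have upper: "d (f n) (k n) \<le> h k" if "k \<in> power_carrier ?S" for k n
    unfolding h_def using that d01 fS
    by (intro cSUP_upper bdd_aboveI2[where M = 1]) (auto simp: power_carrier_def)
  have least: "h k \<le> c" if "\<And>n. d (f n) (k n) \<le> c" for k c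
    unfolding h_def using that by (intro cSUP_least) auto
  have step: "h k \<le> h l + e"
    if kl: "k \<in> power_carrier ?S" "l \<in> power_carrier ?S" and e: "\<And>n. d (l n) (k n) \<le> e" for k l e
  proof (rule least)
    fix n
    have "d (f n) (k n) \<le> d (f n) (l n) + d (l n) (k n)"
      using kl fS by (intro tri) (auto simp: power_carrier_def)
    also have "\<dots> \<le> h l + e" using upper[OF kl(2)] e by (intro add_mono)
    finally show "d (f n) (k n) \<le> h l + e" .
  qed
  have "continuous_map ?Y euclideanreal h"
    unfolding countable_uniform_power_eq
  proof (rule continuous_map_uniform_real[OF uniformity_on_uniform_power])
    fix e :: real assume "e > 0"
    let ?D = "{(x, y). x \<in> ?S \<and> y \<in> ?S \<and> d x y < e / 2}"
    have "\<bar>h k - h l\<bar> < e" if "(k, l) \<in> power_entourage ?S ?D" for k l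
    proof -
      have kl: "k \<in> power_carrier ?S" "l \<in> power_carrier ?S" and "\<And>n. d (k n) (l n) \<le> e / 2"
        using that by (auto simp: power_entourage_def less_imp_le)
      then have "h k \<le> h l + e / 2" "h l \<le> h k + e / 2"
        using step[of k l "e / 2"] step[of l k "e / 2"] dsym by simp_all
      then show ?thesis using \<open>e > 0\<close> by linarith
    qed
    then show "\<exists>U\<in>power_uniformity ?S (diagonal_nbhds X). \<forall>(x, y)\<in>U. \<bar>h x - h y\<bar> < e"
      using power_entourage_in_uniformity[OF nb[of "e / 2"]] \<open>e > 0\<close>
      by (intro bexI[of _ "power_entourage ?S ?D"]) auto
  qed
  moreover have "h f = 0"
    unfolding h_def using d0 fS by simp
  moreover have "h k = 1" if "k \<in> topspace ?Y - W" for k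
  proof -
    have k: "k \<in> power_carrier ?S" and "k \<notin> W"
      using that by (auto simp: topspace_countable_uniform_power)
    have kS: "k n \<in> ?S" for n using k by (simp add: power_carrier_def)
    have "(f, k) \<notin> power_entourage ?S U" using U(2) \<open>k \<notin> W\<close> by blast
    then obtain n where "(f n, k n) \<notin> U"
      using k fS by (auto simp: power_entourage_def power_carrier_def)
    then have "1 \<le> d (f n) (k n)" using dU fS kS by force
    then show ?thesis using upper[OF k, of n] least[of k 1] d01 fS kS by force
  qed
  ultimately show "\<exists>h. continuous_map ?Y euclideanreal h \<and> h f = 0 \<and> h ` (topspace ?Y - W) \<subseteq> {1}"
    by blast
qed

end

section \<open>Zero sets and z-ultrafilters\<close>

lemma zero_set_of_le:
  assumes "continuous_map Y euclideanreal h"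
  shows "zero_set_of Y {y \<in> topspace Y. h y \<le> c}"
  unfolding zero_set_of_def
  by (rule exI[of _ "\<lambda>y. max 0 (h y - c)"]) (auto intro!: continuous_intros assms)

lemma closedin_zero_set_of:
  assumes "zero_set_of Y Z"
  shows "closedin Y Z"
proof -
  obtain h where h: "continuous_map Y euclideanreal h" "Z = {y \<in> topspace Y. h y = 0}"
    using assms by (auto simp: zero_set_of_def)
  have "closedin Y {y \<in> topspace Y. h y \<in> {0}}"
    by (intro closedin_continuous_map_preimage[OF h(1)]) simp
  with h(2) show ?thesis by simp
qed

lemma zero_set_of_Int:
  assumes "zero_set_of Y A" "zero_set_of Y B"
  shows "zero_set_of Y (A \<inter> B)"
proof -
  obtain h k where hk: "continuous_map Y euclideanreal h" "A = {y \<in> topspace Y. h y = 0}"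
    "continuous_map Y euclideanreal k" "B = {y \<in> topspace Y. k y = 0}"
    using assms by (auto simp: zero_set_of_def)
  show ?thesis
    unfolding zero_set_of_def
  proof (intro exI conjI)
    show "continuous_map Y euclideanreal (\<lambda>y. max \<bar>h y\<bar> \<bar>k y\<bar>)"
      by (intro continuous_intros hk)
    have "max \<bar>a\<bar> \<bar>b\<bar> = 0 \<longleftrightarrow> a = 0 \<and> b = 0" for a b :: real
      by linarith
    then show "A \<inter> B = {y \<in> topspace Y. max \<bar>h y\<bar> \<bar>k y\<bar> = 0}"
      unfolding hk(2,4) by blast
  qed
qed

lemma z_filterD:
  assumes "z_filter Y \<F>"
  shows "\<F> \<noteq> {}"
    and "{} \<notin> \<F>"
    and "\<And>Z. Z \<in> \<F> \<Longrightarrow> zero_set_of Y Z"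
    and "\<And>Z Z'. Z \<in> \<F> \<Longrightarrow> Z' \<in> \<F> \<Longrightarrow> Z \<inter> Z' \<in> \<F>"
    and "\<And>Z Z'. Z \<in> \<F> \<Longrightarrow> zero_set_of Y Z' \<Longrightarrow> Z \<subseteq> Z' \<Longrightarrow> Z' \<in> \<F>"
  using assms unfolding z_filter_def by meson+

lemma zero_set_of_subset: "zero_set_of Y Z \<Longrightarrow> Z \<subseteq> topspace Y"
  using closedin_zero_set_of closedin_subset by metis

lemma z_filter_Inter:
  assumes "z_filter Y \<F>" "finite \<C>" "\<C> \<noteq> {}" "\<C> \<subseteq> \<F>"
  shows "\<Inter>\<C> \<in> \<F>"
  using assms(2,3,4)
proof (induction \<C> rule: finite_ne_induct)
  case (insert Z \<C>)
  then show ?case using z_filterD(4)[OF assms(1)] by simp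
qed auto

text \<open>Otherwise the traces on \<open>A\<close> of the members of \<open>\<F>\<close> would generate a strictly larger z-filter.\<close>

lemma z_ultrafilter_disjoint_member:
  assumes \<F>: "z_ultrafilter Y \<F>" and A: "zero_set_of Y A" "A \<notin> \<F>"
  shows "\<exists>Z\<in>\<F>. A \<inter> Z = {}"
proof (rule ccontr)
  assume meet: "\<not> (\<exists>Z\<in>\<F>. A \<inter> Z = {})"
  have z: "z_filter Y \<F>" using \<F> by (simp add: z_ultrafilter_def)
  let ?G = "{Z'. zero_set_of Y Z' \<and> (\<exists>Z\<in>\<F>. A \<inter> Z \<subseteq> Z')}"
  have sub: "\<F> \<subseteq> ?G" using z_filterD(3)[OF z] by blast
  moreover have "z_filter Y ?G"
    unfolding z_filter_def
  proof (intro conjI ballI allI impI)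
    show "?G \<noteq> {}" using sub z_filterD(1)[OF z] by blast
    show "{} \<notin> ?G" using meet by blast
    fix Z Z' assume "Z \<in> ?G" "Z' \<in> ?G"
    then obtain B B' where B: "B \<in> \<F>" "A \<inter> B \<subseteq> Z" "B' \<in> \<F>" "A \<inter> B' \<subseteq> Z'"
      and "zero_set_of Y Z" "zero_set_of Y Z'" by blast
    then have "zero_set_of Y (Z \<inter> Z')" using zero_set_of_Int by metis
    moreover have "B \<inter> B' \<in> \<F>" using B z_filterD(4)[OF z] by simp
    moreover have "A \<inter> (B \<inter> B') \<subseteq> Z \<inter> Z'" using B by blast
    ultimately show "Z \<inter> Z' \<in> ?G" by blast
  next
    fix Z Z' assume "Z \<in> ?G" "zero_set_of Y Z' \<and> Z \<subseteq> Z'"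
    then show "Z' \<in> ?G" by blast
  qed blast
  ultimately have "?G = \<F>" using \<F> unfolding z_ultrafilter_def by meson
  moreover have "A \<in> ?G" using A(1) z_filterD(1)[OF z] by blast
  ultimately show False using A(2) by blast
qed

lemma z_ultrafilter_prime:
  assumes "z_ultrafilter Y \<F>" "zero_set_of Y A" "zero_set_of Y B" "topspace Y \<subseteq> A \<union> B"
  shows "A \<in> \<F> \<or> B \<in> \<F>"
proof (rule ccontr)
  assume "\<not> ?thesis"
  then have "A \<notin> \<F>" and "B \<notin> \<F>" by auto
  with assms obtain Z where Z: "Z \<in> \<F>" "A \<inter> Z = {}" using z_ultrafilter_disjoint_member by metis
  have z: "z_filter Y \<F>" using assms(1) by (simp add: z_ultrafilter_def)
  then have "Z \<subseteq> topspace Y" using Z(1) z_filterD(3) zero_set_of_subset by metis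
  then have "Z \<subseteq> B" using Z(2) assms(4) by blast
  then show False using z_filterD(5)[OF z Z(1) assms(3)] \<open>B \<notin> \<F>\<close> by simp
qed

text \<open>The image of a z-ultrafilter under a continuous map into a compact space converges, in
  the sense that the preimages of the zero sets \<open>{x. h x \<le> c}\<close> with \<open>h p < c\<close> are members.\<close>

lemma z_ultrafilter_image_limit:
  assumes X: "compact_space X" and \<F>: "z_ultrafilter Y \<F>" and \<pi>: "continuous_map Y X \<pi>"
  shows "\<exists>p. p \<in> topspace X \<and>
    (\<forall>h c. continuous_map X euclideanreal h \<and> h p < c \<longrightarrow>
      {y \<in> topspace Y. h (\<pi> y) \<le> c} \<in> \<F>)"
proof -
  have z: "z_filter Y \<F>" using \<F> by (simp add: z_ultrafilter_def)
  \<comment> \<open>The closed sets in the image filter; \<open>p\<close> is one of their common points.\<close>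
  define \<K> where "\<K> = {C. closedin X C \<and> {y \<in> topspace Y. \<pi> y \<in> C} \<in> \<F>}"
  have "topspace Y \<in> \<F>"
  proof -
    have "zero_set_of Y (topspace Y)"
      unfolding zero_set_of_def by (rule exI[of _ "\<lambda>_. 0"]) auto
    moreover obtain Z where "Z \<in> \<F>" using z_filterD(1)[OF z] by blast
    ultimately show ?thesis using z_filterD(3,5)[OF z] zero_set_of_subset by metis
  qed
  have "\<Inter>\<C> \<noteq> {}" if \<C>: "finite \<C>" "\<C> \<subseteq> \<K>" for \<C>
  proof (cases "\<C> = {}")
    case False
    let ?E = "\<lambda>C. {y \<in> topspace Y. \<pi> y \<in> C}"
    have "\<Inter>(?E ` \<C>) \<in> \<F>"
      using \<C> False by (intro z_filter_Inter[OF z]) (auto simp: \<K>_def)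
    then have "\<Inter>(?E ` \<C>) \<noteq> {}" using z_filterD(2)[OF z] by metis
    then obtain y where "y \<in> \<Inter>(?E ` \<C>)" by blast
    then have "\<pi> y \<in> \<Inter>\<C>" using False by blast
    then show ?thesis by blast
  qed simp
  moreover have XK: "topspace X \<in> \<K>"
  proof -
    have "{y \<in> topspace Y. \<pi> y \<in> topspace X} = topspace Y"
      using \<pi> by (auto simp: continuous_map_def)
    then show ?thesis using \<open>topspace Y \<in> \<F>\<close> by (simp add: \<K>_def)
  qed
  moreover have "\<forall>C\<in>\<K>. closedin X C" by (simp add: \<K>_def)
  ultimately have "\<Inter>\<K> \<noteq> {}"
    using X[unfolded compact_space_fip, THEN spec[of _ \<K>]] by simp
  then obtain p where p: "p \<in> \<Inter>\<K>" by blast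
  show ?thesis
  proof (intro exI conjI allI impI)
    show "p \<in> topspace X" using p XK by blast
    fix h :: "'a \<Rightarrow> real" and c
    assume "continuous_map X euclideanreal h \<and> h p < c"
    then have h: "continuous_map X euclideanreal h" and "h p < c" by auto
    have h\<pi>: "continuous_map Y euclideanreal (\<lambda>y. h (\<pi> y))"
      using continuous_map_compose[OF \<pi> h] by (simp add: o_def)
    \<comment> \<open>By primeness one of \<open>h \<circ> \<pi> \<le> c\<close> and \<open>h \<circ> \<pi> \<ge> c\<close> is a member; the second would put \<open>p\<close>
      into the closed set \<open>{x. h x \<ge> c}\<close>.\<close>
    let ?A = "{y \<in> topspace Y. h (\<pi> y) \<le> c}" and ?B = "{y \<in> topspace Y. - h (\<pi> y) \<le> - c}"
    have "?A \<in> \<F> \<or> ?B \<in> \<F>"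
      by (intro z_ultrafilter_prime[OF \<F>] zero_set_of_le h\<pi> continuous_intros) auto
    moreover have "?B \<notin> \<F>"
    proof
      assume B: "?B \<in> \<F>"
      let ?C = "{x \<in> topspace X. h x \<in> {c..}}"
      have "closedin X ?C" by (intro closedin_continuous_map_preimage[OF h]) simp
      moreover have "{y \<in> topspace Y. \<pi> y \<in> ?C} = ?B"
        using \<pi> by (auto simp: continuous_map_def)
      ultimately have "?C \<in> \<K>" using B by (simp add: \<K>_def)
      then show False using p \<open>h p < c\<close> by fastforce
    qed
    ultimately show "?A \<in> \<F>" by blast
  qed
qed

section \<open>Realcompactness\<close>

theorem proposition5p4:
  fixes X :: "'a topology"
  assumes "compact_space X" and "Hausdorff_space X"
  shows "realcompact_space (countable_uniform_power X)"
  unfolding realcompact_space_def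
proof (intro conjI allI impI)
  let ?Y = "countable_uniform_power X" and ?S = "topspace X"
  show "completely_regular_space ?Y" "Hausdorff_space ?Y"
    using completely_regular_countable_uniform_power[OF assms]
      Hausdorff_countable_uniform_power[OF assms] .
  fix \<F> assume "z_ultrafilter ?Y \<F> \<and> countable_intersection_property \<F>"
  then have \<F>: "z_ultrafilter ?Y \<F>" and cip: "countable_intersection_property \<F>" by auto
  have "\<exists>p. \<forall>n. p n \<in> ?S \<and>
          (\<forall>h c. continuous_map X euclideanreal h \<and> h (p n) < c \<longrightarrow>
            {f \<in> topspace ?Y. h (f n) \<le> c} \<in> \<F>)"
    using z_ultrafilter_image_limit[OF assms(1) \<F> continuous_map_evaluation[OF assms]]
    by (intro choice allI)
  then obtain p where p: "\<forall>n. p n \<in> ?S \<and>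
          (\<forall>h c. continuous_map X euclideanreal h \<and> h (p n) < c \<longrightarrow>
            {f \<in> topspace ?Y. h (f n) \<le> c} \<in> \<F>)" ..
  then have pS: "p n \<in> ?S" for n by simp
  have "p \<in> Z" if Z: "Z \<in> \<F>" for Z
  proof (rule ccontr)
    assume "p \<notin> Z"
    have "zero_set_of ?Y Z"
      using \<F> Z z_filterD(3) unfolding z_ultrafilter_def by metis
    then have "openin ?Y (topspace ?Y - Z)"
      by (intro openin_diff closedin_zero_set_of) auto
    moreover have "p \<in> topspace ?Y - Z"
      using pS \<open>p \<notin> Z\<close> by (simp add: topspace_countable_uniform_power[OF assms] power_carrier_def)
    ultimately obtain U where U: "U \<in> diagonal_nbhds X"
      "power_entourage ?S U `` {p} \<subseteq> topspace ?Y - Z"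
      unfolding openin_countable_uniform_power[OF assms] by blast
    \<comment> \<open>The set \<open>{x. h x \<le> 1/2}\<close> is a zero-set neighbourhood of \<open>p n\<close> inside \<open>U `` {p n}\<close>.\<close>
    have "\<exists>h. continuous_map X euclideanreal h \<and> h (p n) = (0::real) \<and>
            (\<forall>x\<in>?S. h x \<le> 1/2 \<longrightarrow> (p n, x) \<in> U)" for n
    proof -
      obtain A where A: "openin X A" "p n \<in> A" "A \<times> A \<subseteq> U"
        using diagonal_nbhdsD[OF U(1) pS] .
      have "completely_regular_space X"
        using assms by (simp add: normal_imp_completely_regular_space
            compact_Hausdorff_or_regular_imp_normal_space)
      then obtain h :: "'a \<Rightarrow> real" where h: "continuous_map X euclideanreal h" "h (p n) = 0"
        "h ` (?S - A) \<subseteq> {1}"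
        using A unfolding completely_regular_space_alt' by metis
      have "x \<in> A" if "x \<in> ?S" "h x \<le> 1/2" for x
      proof (rule ccontr)
        assume "x \<notin> A"
        with that(1) h(3) have "h x = 1" by blast
        with that(2) show False by simp
      qed
      with h A show ?thesis by blast
    qed
    then obtain h :: "nat \<Rightarrow> 'a \<Rightarrow> real" where h: "\<And>n. continuous_map X euclideanreal (h n)"
      "\<And>n. h n (p n) = 0" "\<And>n x. x \<in> ?S \<Longrightarrow> h n x \<le> 1/2 \<Longrightarrow> (p n, x) \<in> U"
      by metis
    let ?E = "\<lambda>n. {f \<in> topspace ?Y. h n (f n) \<le> 1/2}"
    have "?E n \<in> \<F>" for n
      using p[THEN spec[of _ n], THEN conjunct2, THEN spec[of _ "h n"], THEN spec[of _ "1/2"]]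
        h(1,2)[of n] by simp
    then have "insert Z (range ?E) \<subseteq> \<F>"
      using Z by blast
    then have "\<Inter>(insert Z (range ?E)) \<noteq> {}"
      using cip[unfolded countable_intersection_property_def, THEN spec[of _ "insert Z (range ?E)"]]
      by simp
    then have "\<exists>f. f \<in> \<Inter>(insert Z (range ?E))" by (simp only: ex_in_conv simp_thms)
    then obtain f where "f \<in> \<Inter>(insert Z (range ?E))" ..
    then have f: "f \<in> Z" and fE: "\<forall>n. f \<in> ?E n" by simp_all
    then have fS: "f \<in> power_carrier ?S"
      by (simp add: topspace_countable_uniform_power[OF assms])
    then have "(p n, f n) \<in> U" for n
      using h(3)[of "f n" n] fE by (simp add: power_carrier_def)
    then have "(p, f) \<in> power_entourage ?S U"
      using fS pS by (simp add: power_entourage_def power_carrier_def)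
    with U(2) f show False by blast
  qed
  then show "\<Inter>\<F> \<noteq> {}" by blast
qed

end
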